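(* Let $C$ be a Clifford gate on $n$ qubits and let $$h\in\mathrm{span}_{\mathbb{R}}\Bigl\{\bigotimes_{l=1}^n\sigma^{\alpha_l}_l \;\Big|\; \alpha_l\in\{0,1,2,3\}\Bigr\}.$$ Then $|h|_{\mathrm{card}}=|ChC^\dagger|_{\mathrm{card}}$.
   Context: $\sigma^0=\mathbb{1},\sigma^1=X,\sigma^2=Y,\sigma^3=Z$ are the identity and Pauli matrices. For a Hermitian operator $h=\sum_k h_kP_k$ expanded over the $4^n$ distinct Pauli strings $P_k\in\{\mathbb{1},X,Y,Z\}^{\otimes n}$, the cardinality $|h|_{\mathrm{card}}$ is the number of nonzero coefficients $h_k$. The Pauli group is $\mathbf{P}_n=\{e^{i\theta\pi/2}\bigotimes_{j=1}^n\sigma^{\alpha_j}\mid\theta,\alpha_j\in\{0,1,2,3\}\}$, and a Clifford gate is an element of $\mathbf{C}_n=\{C\in\mathbf{U}(2^n)\mid C\mathbf{P}_nC^\dagger=\mathbf{P}_n\}$. *)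

theory Defs
  imports "HOL-Analysis.Analysis"
begin

text \<open>
  The qubits are labelled by a finite type \<open>'n\<close>, so that \<open>n = CARD('n)\<close>. The computational basis
  of the \<open>n\<close>-qubit space consists of the assignments \<open>'n \<Rightarrow> 2\<close> of a basis index to every qubit;
  there are \<open>2 ^ n\<close> of them, and operators are complex matrices whose rows and columns are
  indexed by them. Real scalar multiples and real spans of operators are those of the type
  class \<open>real_vector\<close>.
\<close>

type_synonym 'n operator = "complex ^ ('n \<Rightarrow> 2) ^ ('n \<Rightarrow> 2)"

definition adjoint_matrix :: "complex ^ 'a ^ 'b \<Rightarrow> complex ^ 'b ^ 'a" where
  "adjoint_matrix A = (\<chi> i j. cnj (A $ j $ i))"

definition unitary_matrix :: "complex ^ 'a ^ 'a \<Rightarrow> bool" where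
  "unitary_matrix U \<longleftrightarrow> U ** adjoint_matrix U = mat 1 \<and> adjoint_matrix U ** U = mat 1"

definition scale_matrix :: "complex \<Rightarrow> complex ^ 'a ^ 'b \<Rightarrow> complex ^ 'a ^ 'b" where
  "scale_matrix c A = (\<chi> i j. c * A $ i $ j)"

text \<open>Junk value for indices above 3; these are excluded wherever Pauli strings are formed.\<close>

definition pauli_matrix :: "nat \<Rightarrow> complex ^ 2 ^ 2" where
  "pauli_matrix k =
    (if k = 0 then mat 1
     else if k = 1 then vector [vector [0, 1], vector [1, 0]]
     else if k = 2 then vector [vector [0, - \<i>], vector [\<i>, 0]]
     else vector [vector [1, 0], vector [0, - 1]])"

text \<open>In the product basis, the entries of a tensor product are products of entries.\<close>

definition tensor :: "('n \<Rightarrow> complex ^ 2 ^ 2) \<Rightarrow> 'n::finite operator" where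
  "tensor A = (\<chi> x y. \<Prod>l\<in>UNIV. A l $ x l $ y l)"

definition pauli_string :: "('n \<Rightarrow> nat) \<Rightarrow> 'n::finite operator" where
  "pauli_string \<alpha> = tensor (\<lambda>l. pauli_matrix (\<alpha> l))"

definition pauli_strings :: "'n::finite operator set" where
  "pauli_strings = {pauli_string \<alpha> | \<alpha>. \<forall>l. \<alpha> l \<in> {0, 1, 2, 3}}"

definition pauli_group :: "'n::finite operator set" where
  "pauli_group =
    {scale_matrix (exp (\<i> * of_nat \<theta> * of_real pi / 2)) (pauli_string \<alpha>) | \<theta> \<alpha>.
      \<theta> \<in> {0, 1, 2, 3} \<and> (\<forall>l. \<alpha> l \<in> {0, 1, 2, 3})}"

definition clifford_group :: "'n::finite operator set" where
  "clifford_group =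
    {C. unitary_matrix C \<and> (\<lambda>P. C ** P ** adjoint_matrix C) ` pauli_group = pauli_group}"

text \<open>
  The number of nonzero coefficients in the expansion over the Pauli strings.
  \<open>representation B h P\<close> is the coefficient of \<open>P\<close> in the expansion of \<open>h\<close> over \<open>B\<close>, provided that
  \<open>B\<close> is linearly independent and \<open>h\<close> lies in its real span (otherwise it is 0). The lemmas
  below show that the Pauli strings are independent and that the count is the intended one.
\<close>

definition pauli_card :: "'n::finite operator \<Rightarrow> nat" where
  "pauli_card h = card {P \<in> pauli_strings. representation pauli_strings h P \<noteq> 0}"

lemma sum_tensor:
  fixes F :: "'n::finite \<Rightarrow> 2 \<Rightarrow> 2 \<Rightarrow> complex"
  shows "(\<Sum>x\<in>UNIV. \<Sum>y\<in>UNIV. \<Prod>l\<in>UNIV. F l (x l) (y l))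
    = (\<Prod>l\<in>UNIV. \<Sum>u\<in>UNIV. \<Sum>v\<in>UNIV. F l u v)"
proof -
  have P: "(\<Prod>l\<in>UNIV. \<Sum>v\<in>UNIV. G l v) = (\<Sum>y\<in>UNIV. \<Prod>l\<in>UNIV. G l (y l))"
    for G :: "'n \<Rightarrow> 2 \<Rightarrow> complex"
    using prod_sum_PiE[of "UNIV :: 'n set" "\<lambda>_. UNIV :: 2 set" G] by (simp add: PiE_UNIV_domain)
  show ?thesis
    unfolding P[of "\<lambda>l u. \<Sum>v\<in>UNIV. F l u v"] by (rule sum.cong[OF refl]) (rule P[symmetric])
qed

lemma pauli_matrix_orthogonal:
  assumes "a \<in> {0, 1, 2, 3}" "b \<in> {0, 1, 2, 3}"
  shows "(\<Sum>u\<in>UNIV. \<Sum>v\<in>UNIV. pauli_matrix a $ u $ v * cnj (pauli_matrix b $ u $ v)) = (if a = b then 2 else 0)"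
  using assms by (auto simp: pauli_matrix_def sum_2 mat_def)

lemma pauli_string_inner:
  fixes \<alpha> \<beta> :: "'n::finite \<Rightarrow> nat"
  assumes "\<forall>l. \<alpha> l \<in> {0, 1, 2, 3}" "\<forall>l. \<beta> l \<in> {0, 1, 2, 3}"
  shows "inner (pauli_string \<alpha>) (pauli_string \<beta>) = (if \<alpha> = \<beta> then 2 ^ CARD('n) else 0)"
proof -
  have c: "inner a b = Re (a * cnj b)" for a b :: complex
    by (simp add: inner_complex_def)
  have "inner (pauli_string \<alpha>) (pauli_string \<beta>)
    = Re (\<Sum>x\<in>UNIV. \<Sum>y\<in>UNIV. \<Prod>l\<in>UNIV.
        pauli_matrix (\<alpha> l) $ x l $ y l * cnj (pauli_matrix (\<beta> l) $ x l $ y l))"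
    by (simp add: inner_vec_def c pauli_string_def tensor_def prod.distrib)
  also have "\<dots> = Re (\<Prod>l\<in>UNIV. if \<alpha> l = \<beta> l then 2 else 0)"
    using assms by (subst sum_tensor) (simp only: pauli_matrix_orthogonal)
  also have "\<dots> = (if \<alpha> = \<beta> then 2 ^ CARD('n) else 0)"
  proof (cases "\<alpha> = \<beta>")
    case True
    have "Re (2 ^ CARD('n)) = 2 ^ CARD('n)"
      by (metis Re_complex_of_real of_real_numeral of_real_power)
    with True show ?thesis by simp
  next
    case False
    then obtain l where "\<alpha> l \<noteq> \<beta> l" by auto
    then have "(\<Prod>l\<in>UNIV. if \<alpha> l = \<beta> l then 2 else 0 :: complex) = 0"
      by (intro prod_zero) auto
    with False show ?thesis by (simp only: if_False zero_complex.sel)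
  qed
  finally show ?thesis .
qed

lemma inj_on_pauli_string: "inj_on pauli_string {\<alpha> :: 'n::finite \<Rightarrow> nat. \<forall>l. \<alpha> l \<in> {0, 1, 2, 3}}"
proof (rule inj_onI)
  fix \<alpha> \<beta> :: "'n \<Rightarrow> nat"
  assume *: "\<alpha> \<in> {\<alpha>. \<forall>l. \<alpha> l \<in> {0, 1, 2, 3}}" "\<beta> \<in> {\<alpha>. \<forall>l. \<alpha> l \<in> {0, 1, 2, 3}}"
    "pauli_string \<alpha> = pauli_string \<beta>"
  then have "inner (pauli_string \<alpha>) (pauli_string \<beta>) = 2 ^ CARD('n)"
    using pauli_string_inner[of \<alpha> \<alpha>] by simp
  then show "\<alpha> = \<beta>"
    using * pauli_string_inner[of \<alpha> \<beta>] by (auto split: if_splits)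
qed

lemma independent_pauli_strings: "independent (pauli_strings :: 'n::finite operator set)"
proof (rule pairwise_orthogonal_independent)
  show "pairwise orthogonal (pauli_strings :: 'n operator set)"
  proof (rule pairwiseI)
    fix P Q :: "'n operator"
    assume "P \<in> pauli_strings" "Q \<in> pauli_strings" "P \<noteq> Q"
    then obtain \<alpha> \<beta> where
      \<alpha>: "P = pauli_string \<alpha>" "\<forall>l. \<alpha> l \<in> {0, 1, 2, 3}" and
      \<beta>: "Q = pauli_string \<beta>" "\<forall>l. \<beta> l \<in> {0, 1, 2, 3}"
      unfolding pauli_strings_def by blast
    with \<open>P \<noteq> Q\<close> have "\<alpha> \<noteq> \<beta>" by blast
    then show "orthogonal P Q"
      using pauli_string_inner[OF \<alpha>(2) \<beta>(2)] by (simp add: orthogonal_def \<alpha>(1) \<beta>(1))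
  qed
  show "0 \<notin> (pauli_strings :: 'n operator set)"
  proof
    assume "0 \<in> (pauli_strings :: 'n operator set)"
    then obtain \<alpha> :: "'n \<Rightarrow> nat" where "\<forall>l. \<alpha> l \<in> {0, 1, 2, 3}" "pauli_string \<alpha> = 0"
      unfolding pauli_strings_def mem_Collect_eq by metis
    then show False using pauli_string_inner[of \<alpha> \<alpha>] by simp
  qed
qed

lemma pauli_card_sum:
  fixes c :: "('n::finite \<Rightarrow> nat) \<Rightarrow> real"
  shows "pauli_card (\<Sum>\<alpha> | \<forall>l. \<alpha> l \<in> {0, 1, 2, 3}. c \<alpha> *\<^sub>R pauli_string \<alpha>)
    = card {\<alpha>. (\<forall>l. \<alpha> l \<in> {0, 1, 2, 3}) \<and> c \<alpha> \<noteq> 0}"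
proof -
  define I where "I = {\<alpha> :: 'n \<Rightarrow> nat. \<forall>l. \<alpha> l \<in> {0, 1, 2, 3}}"
  have S: "pauli_strings = pauli_string ` I"
    by (auto simp: pauli_strings_def I_def)
  have inj: "inj_on pauli_string I"
    unfolding I_def by (rule inj_on_pauli_string)
  have "I = PiE UNIV (\<lambda>_. {0, 1, 2, 3})"
    unfolding I_def PiE_UNIV_domain by (simp only: Pi_def UNIV_I simp_thms)
  then have fin: "finite I"
    by (simp add: finite_PiE)
  define r where "r P = (if P \<in> pauli_strings then c (inv_into I pauli_string P) else 0)" for P
  have r: "r (pauli_string \<alpha>) = c \<alpha>" if "\<alpha> \<in> I" for \<alpha>
    using that inj by (simp add: r_def S)
  have "representation pauli_strings (\<Sum>\<alpha>\<in>I. c \<alpha> *\<^sub>R pauli_string \<alpha>) = r"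
  proof (rule representation_eqI[OF independent_pauli_strings])
    show "(\<Sum>\<alpha>\<in>I. c \<alpha> *\<^sub>R pauli_string \<alpha>) \<in> span pauli_strings"
      by (intro span_sum span_scale span_base) (simp add: S)
    show "P \<in> pauli_strings" if "r P \<noteq> 0" for P
      using that by (simp add: r_def split: if_splits)
    have sub: "{P. r P \<noteq> 0} \<subseteq> pauli_strings"
      by (auto simp: r_def)
    then show "finite {P. r P \<noteq> 0}"
      by (rule finite_subset) (simp add: S fin)
    have "(\<Sum>P | r P \<noteq> 0. r P *\<^sub>R P) = (\<Sum>P\<in>pauli_strings. r P *\<^sub>R P)"
      using sub by (intro sum.mono_neutral_left) (auto simp: S fin)
    also have "\<dots> = (\<Sum>\<alpha>\<in>I. c \<alpha> *\<^sub>R pauli_string \<alpha>)"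
      unfolding S by (simp add: sum.reindex[OF inj] r)
    finally show "(\<Sum>P | r P \<noteq> 0. r P *\<^sub>R P) = (\<Sum>\<alpha>\<in>I. c \<alpha> *\<^sub>R pauli_string \<alpha>)" .
  qed
  then have "pauli_card (\<Sum>\<alpha>\<in>I. c \<alpha> *\<^sub>R pauli_string \<alpha>) = card {P \<in> pauli_strings. r P \<noteq> 0}"
    by (simp add: pauli_card_def)
  also have "{P \<in> pauli_strings. r P \<noteq> 0} = pauli_string ` {\<alpha> \<in> I. c \<alpha> \<noteq> 0}"
    using r by (auto simp: S)
  also have "card \<dots> = card {\<alpha> \<in> I. c \<alpha> \<noteq> 0}"
    by (rule card_image) (rule inj_on_subset[OF inj], auto)
  finally show ?thesis
    by (simp add: I_def)
qed

end

theory Submission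
  imports Defs
begin

text \<open>
  Conjugation by a unitary preserves the real inner product \<open>Re (tr (A B\<^sup>\<dagger>))\<close>. If the unitary is
  Clifford, it maps a Pauli string to a phase times a Pauli string, and the phase is \<open>\<plusminus>1\<close> because
  Pauli strings are Hermitian. So it permutes the Pauli strings up to sign. As these are
  orthogonal, the coefficient at \<open>P\<close> vanishes iff the inner product with \<open>P\<close> does, and
  the permutation matches up the nonzero coefficients of \<open>h\<close> and of its conjugate.
\<close>

definition conjugate_by :: "complex ^ 'a ^ 'a \<Rightarrow> complex ^ 'a ^ 'a \<Rightarrow> complex ^ 'a ^ 'a" where
  "conjugate_by C A = C ** A ** adjoint_matrix C"

lemma adjoint_matrix_adjoint_matrix [simp]: "adjoint_matrix (adjoint_matrix A) = A"
  by (simp add: adjoint_matrix_def vec_eq_iff)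

lemma adjoint_matrix_mult:
  fixes A :: "complex ^ 'b::finite ^ 'c::finite"
  shows "adjoint_matrix (A ** B) = adjoint_matrix B ** adjoint_matrix A"
  by (simp add: adjoint_matrix_def matrix_matrix_mult_def vec_eq_iff mult.commute)

lemma adjoint_matrix_scale: "adjoint_matrix (scale_matrix c A) = scale_matrix (cnj c) (adjoint_matrix A)"
  by (simp add: adjoint_matrix_def scale_matrix_def vec_eq_iff)

text \<open>The entrywise real inner product becomes a trace, so that cyclicity of the trace can be
  used on conjugates.\<close>

lemma inner_matrix_eq_trace:
  fixes A B :: "complex ^ 'a::finite ^ 'a"
  shows "inner A B = Re (trace (A ** adjoint_matrix B))"
  by (simp add: inner_vec_def trace_def matrix_matrix_mult_def adjoint_matrix_def inner_complex_def)

lemma linear_conjugate_by: "linear (conjugate_by C)"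
  for C :: "complex ^ 'a::finite ^ 'a"
proof
  show "conjugate_by C (A + B) = conjugate_by C A + conjugate_by C B" for A B
    by (simp add: conjugate_by_def matrix_matrix_mult_def vec_eq_iff algebra_simps sum.distrib)
  show "conjugate_by C (r *\<^sub>R A) = r *\<^sub>R conjugate_by C A" for r A
    by (simp add: conjugate_by_def matrix_matrix_mult_def vec_eq_iff flip: scaleR_sum_right)
qed

lemma adjoint_conjugate_by: "adjoint_matrix (conjugate_by C A) = conjugate_by C (adjoint_matrix A)"
  for C :: "complex ^ 'a::finite ^ 'a"
  by (simp add: conjugate_by_def adjoint_matrix_mult matrix_mul_assoc)

text \<open>In the product under the trace the inner pair \<open>?D ** C\<close> cancels at once;
  the outer pair becomes adjacent by cyclicity and then cancels too.\<close>

lemma inner_conjugate_by: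
  fixes C :: "complex ^ 'a::finite ^ 'a"
  assumes "unitary_matrix C"
  shows "inner (conjugate_by C A) (conjugate_by C B) = inner A B"
proof -
  let ?D = "adjoint_matrix C"
  have CD: "?D ** C = mat 1"
    using assms by (simp add: unitary_matrix_def)
  have "conjugate_by C A ** adjoint_matrix (conjugate_by C B)
      = C ** A ** (?D ** C) ** adjoint_matrix B ** ?D"
    unfolding adjoint_conjugate_by by (simp add: conjugate_by_def matrix_mul_assoc)
  also have "\<dots> = C ** (A ** adjoint_matrix B ** ?D)"
    unfolding CD by (simp add: matrix_mul_assoc)
  finally have "trace (conjugate_by C A ** adjoint_matrix (conjugate_by C B))
      = trace (A ** adjoint_matrix B ** ?D ** C)"
    by (simp only: trace_mul_sym[of C])
  also have "A ** adjoint_matrix B ** ?D ** C = A ** adjoint_matrix B"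
    by (metis CD matrix_mul_assoc matrix_mul_rid)
  finally show ?thesis
    by (simp add: inner_matrix_eq_trace)
qed

text \<open>The default value for indices above 3 is the matrix Z, which is also Hermitian, so
  \<open>k\<close> ranges over all naturals.\<close>

lemma pauli_matrix_hermitian: "cnj (pauli_matrix k $ u $ v) = pauli_matrix k $ v $ u"
  using exhaust_2[of u] exhaust_2[of v] by (auto simp: pauli_matrix_def mat_def)

lemma adjoint_pauli_string: "adjoint_matrix (pauli_string \<alpha>) = pauli_string \<alpha>"
  by (simp add: adjoint_matrix_def pauli_string_def tensor_def vec_eq_iff pauli_matrix_hermitian)

lemma finite_pauli_strings: "finite (pauli_strings :: 'n::finite operator set)"
  using independent_pauli_strings by (rule independent_imp_finite)

lemma inner_pauli_strings:
  fixes P Q :: "'n::finite operator"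
  assumes "P \<in> pauli_strings" "Q \<in> pauli_strings"
  shows "inner P Q = (if P = Q then 2 ^ CARD('n) else 0)"
proof -
  obtain \<alpha> where \<alpha>: "P = pauli_string \<alpha>" "\<forall>l. \<alpha> l \<in> {0, 1, 2, 3}"
    using assms(1) unfolding pauli_strings_def by blast
  obtain \<beta> where \<beta>: "Q = pauli_string \<beta>" "\<forall>l. \<beta> l \<in> {0, 1, 2, 3}"
    using assms(2) unfolding pauli_strings_def by blast
  have "P = Q \<longleftrightarrow> \<alpha> = \<beta>"
    using inj_on_eq_iff[OF inj_on_pauli_string, of \<alpha> \<beta>] \<alpha> \<beta> by simp
  then show ?thesis
    using pauli_string_inner[OF \<alpha>(2) \<beta>(2)] by (simp only: \<alpha>(1) \<beta>(1))
qed

text \<open>Distinct strings are orthogonal, whereas \<open>- Q\<close> and \<open>Q\<close> have a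
  nonzero inner product. This makes dropping signs harmless for injectivity.\<close>

lemma pauli_string_eq_up_to_sign:
  fixes P Q :: "'n::finite operator"
  assumes "P \<in> pauli_strings" "Q \<in> pauli_strings" "P = Q \<or> P = - Q"
  shows "P = Q"
proof (rule ccontr)
  assume "P \<noteq> Q"
  then have "P = - Q" "inner P Q = 0"
    using assms inner_pauli_strings[of P Q] by auto
  then show False
    using inner_pauli_strings[of Q Q] assms by simp
qed

text \<open>Pairing the expansion of \<open>h\<close> with \<open>P\<close> leaves
  \<open>2 ^ CARD('n)\<close> times the coefficient at \<open>P\<close>. Coefficients can thus be
  traded for inner products, which conjugation preserves.\<close>

lemma representation_pauli_string_eq_0_iff:
  fixes h P :: "'n::finite operator"
  assumes h: "h \<in> span pauli_strings" and P: "P \<in> pauli_strings"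
  shows "representation pauli_strings h P = 0 \<longleftrightarrow> inner h P = 0"
proof -
  let ?r = "representation pauli_strings h"
  have "inner h P = inner (\<Sum>Q\<in>pauli_strings. ?r Q *\<^sub>R Q) P"
    by (simp add: sum_representation_eq[OF independent_pauli_strings h finite_pauli_strings])
  also have "\<dots> = (\<Sum>Q\<in>pauli_strings. if Q = P then ?r P * 2 ^ CARD('n) else 0)"
    unfolding inner_sum_left using P by (intro sum.cong) (auto simp: inner_pauli_strings)
  also have "\<dots> = ?r P * 2 ^ CARD('n)"
    using P sum.delta[OF finite_pauli_strings, of P "\<lambda>_. ?r P * 2 ^ CARD('n)"] by simp
  finally show ?thesis by simp
qed

lemma clifford_conjugate_pauli_string:
  fixes C P :: "'n::finite operator"
  assumes C: "C \<in> clifford_group" and P: "P \<in> pauli_strings"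
  shows "conjugate_by C P \<in> pauli_strings \<or> - conjugate_by C P \<in> pauli_strings"
proof -
  obtain \<alpha> where \<alpha>: "P = pauli_string \<alpha>" "\<forall>l. \<alpha> l \<in> {0, 1, 2, 3}"
    using P unfolding pauli_strings_def by blast
  have "P = scale_matrix (exp (\<i> * of_nat 0 * of_real pi / 2)) (pauli_string \<alpha>)"
    by (simp add: \<alpha> scale_matrix_def vec_eq_iff)
  then have "P \<in> pauli_group"
    unfolding pauli_group_def using \<alpha>(2) by blast
  then have "conjugate_by C P \<in> pauli_group"
    using C unfolding clifford_group_def conjugate_by_def by blast
  then obtain \<theta> :: nat and \<beta> where
    \<theta>: "conjugate_by C P = scale_matrix (exp (\<i> * of_nat \<theta> * of_real pi / 2)) (pauli_string \<beta>)"
    and \<beta>: "\<forall>l. \<beta> l \<in> {0, 1, 2, 3}"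
    unfolding pauli_group_def by blast
  define c where "c = exp (\<i> * of_nat \<theta> * of_real pi / 2)"
  define Q where "Q = pauli_string \<beta>"
  have Q: "Q \<in> pauli_strings"
    using \<beta> unfolding pauli_strings_def Q_def by blast
  have eq: "conjugate_by C P = scale_matrix c Q"
    by (simp only: \<theta> c_def Q_def)
  \<comment> \<open>Both \<open>P\<close> and \<open>Q\<close> are Hermitian, so taking the adjoint
    fixes the conjugate of \<open>P\<close> and changes only the phase on the right.\<close>
  have "scale_matrix (cnj c) Q = scale_matrix c Q"
    by (metis eq \<alpha>(1) Q_def adjoint_conjugate_by adjoint_matrix_scale adjoint_pauli_string)
  moreover have "Q \<noteq> 0"
    using inner_pauli_strings[OF Q Q] by auto
  ultimately have "cnj c = c"
    by (auto simp: scale_matrix_def vec_eq_iff)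
  moreover have "norm c = 1"
    by (simp add: c_def)
  \<comment> \<open>A real number of modulus 1 is a sign.\<close>
  ultimately have "c = 1 \<or> c = - 1"
    by (auto simp: complex_eq_iff cmod_def)
  then have "conjugate_by C P = Q \<or> conjugate_by C P = - Q"
    unfolding eq by (auto simp: scale_matrix_def vec_eq_iff)
  then show ?thesis
    using Q by auto
qed

theorem lemma2:
  fixes C h :: "'n::finite operator"
  assumes "C \<in> clifford_group"
    and "h \<in> span pauli_strings"
  shows "pauli_card h = pauli_card (C ** h ** adjoint_matrix C)"
proof -
  let ?S = "pauli_strings :: 'n operator set"
  let ?f = "conjugate_by C"
  have unitary: "unitary_matrix C"
    using assms(1) by (simp add: clifford_group_def)
  interpret f: linear ?f
    by (rule linear_conjugate_by)
  \<comment> \<open>An isometry is injective: \<open>A - B\<close> and its image have the same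
    norm.\<close>
  have f_eq_iff: "?f A = ?f B \<longleftrightarrow> A = B" for A B
    using inner_conjugate_by[OF unitary, of "A - B" "A - B"] by (auto simp: f.diff)
  \<comment> \<open>The conjugate with its sign removed, hence again a Pauli string when
    \<open>P\<close> is one.\<close>
  define \<pi> where "\<pi> P = (if ?f P \<in> ?S then ?f P else - ?f P)" for P
  have \<pi>_in: "\<pi> P \<in> ?S" if "P \<in> ?S" for P
    using clifford_conjugate_pauli_string[OF assms(1) that] by (auto simp: \<pi>_def)
  have inj: "inj_on \<pi> ?S"
  proof (rule inj_onI)
    fix P Q assume PQ: "P \<in> ?S" "Q \<in> ?S" and "\<pi> P = \<pi> Q"
    then have "?f P = ?f Q \<or> ?f P = ?f (- Q)"
      unfolding \<pi>_def f.neg by (metis minus_minus)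
    then show "P = Q"
      using PQ pauli_string_eq_up_to_sign f_eq_iff by blast
  qed
  \<comment> \<open>An injective self-map of a finite set is onto, so every coefficient of the
    conjugate is reached.\<close>
  then have surj: "\<pi> ` ?S = ?S"
    using \<pi>_in by (intro endo_inj_surj finite_pauli_strings) auto
  \<comment> \<open>The sign hidden in \<open>\<pi>\<close> may negate the inner product but cannot
    affect whether it vanishes.\<close>
  have "inner (?f h) (\<pi> P) = 0 \<longleftrightarrow> inner h P = 0" for P
    by (simp add: \<pi>_def inner_conjugate_by[OF unitary])
  then have "\<pi> ` {P \<in> ?S. inner h P \<noteq> 0} = {P \<in> \<pi> ` ?S. inner (?f h) P \<noteq> 0}"
    by auto
  then have "bij_betw \<pi> {P \<in> ?S. inner h P \<noteq> 0} {P \<in> ?S. inner (?f h) P \<noteq> 0}"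
    using inj surj by (auto simp: bij_betw_def intro: inj_on_subset)
  then have "card {P \<in> ?S. inner h P \<noteq> 0} = card {P \<in> ?S. inner (?f h) P \<noteq> 0}"
    by (rule bij_betw_same_card)
  \<comment> \<open>Outside the span \<open>representation\<close> is 0 by default; membership is
    what allows the coefficients of the conjugate to be read off from inner products.\<close>
  moreover have "?f h \<in> span ?S"
  proof -
    have "?f P \<in> span ?S" if "P \<in> ?S" for P
      using clifford_conjugate_pauli_string[OF assms(1) that] span_neg[of "- ?f P"]
      by (auto intro: span_base)
    then have "span (?f ` ?S) \<subseteq> span ?S"
      by (intro span_minimal subspace_span) auto
    then show ?thesis
      using assms(2) linear_span_image[OF linear_conjugate_by] by blast
  qed
  ultimately show ?thesis
    using assms(2) unfolding pauli_card_def conjugate_by_def[symmetric]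
    by (simp add: representation_pauli_string_eq_0_iff cong: conj_cong)
qed

end
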